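(* Let $q$ be a prime power and let $M$ be a connected simple matroid of rank $r$ that is representable over $GF(q)$. Let $A_1=[I_r|D_1],\dots,A_k=[I_r|D_k]$ be matrices over $GF(q)$ representing $M$ such that every matrix $[I_r|D]$ over $GF(q)$ representing $M$ is geometrically equivalent to exactly one of $A_1,\dots,A_k$. Then the matroids $M[\,I_r|D_i|x\,]$, where $1\le i\le k$ and $x$ ranges over the columns of $L$ that are not scalar multiples of columns of $D_i$, include, up to isomorphism, all simple rank-$r$ single-element extensions of $M$ that are representable over $GF(q)$.
   Context: For a matrix $A$ over a field, $M[A]$ denotes the vector matroid of $A$, whose ground set is the set of column labels of $A$; $A$ represents $M$ if $M=M[A]$. Two $r\times n$ matrices $A$ and $A'$ representing the same matroid $M$ over a field are geometrically equivalent representations of $M$ if one can be obtained from the other by a sequence of elementary row operations, column scalings (by nonzero scalars) and column permutations (the labels on the columns are disregarded). The projective geometry $PG(r-1,q)$ is represented by the matrix $P=[I_r|L]$ over $GF(q)$ whose columns are obtained by selecting from each one-dimensional subspace of $V(r,q)=GF(q)^r$ the unique vector whose first nonzero entry is $1$; the columns of $L$ are those columns of $P$ that are not standard basis vectors. A single-element extension of $M$ is a matroid $N$ with an element $e$ such that $N\backslash e=M$. *)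

theory Defs
  imports
    "Jordan_Normal_Form.Column_Operations"
    "Jordan_Normal_Form.VS_Connect"
    "HOL-Number_Theory.Prime_Powers"
begin

section \<open>Matroids\<close>

record 'e independence_structure =
  ground :: "'e set"
  indeps :: "'e set set"

definition matroid :: "'e independence_structure \<Rightarrow> bool" where
  "matroid M \<longleftrightarrow>
     finite (ground M) \<and> indeps M \<subseteq> Pow (ground M) \<and>
     {} \<in> indeps M \<and>
     (\<forall>I\<in>indeps M. \<forall>J\<subseteq>I. J \<in> indeps M) \<and>
     (\<forall>I\<in>indeps M. \<forall>J\<in>indeps M. card I < card J \<longrightarrow>
        (\<exists>e\<in>J - I. insert e I \<in> indeps M))"

definition matroid_rank :: "'e independence_structure \<Rightarrow> nat" where
  "matroid_rank M = Max (card ` indeps M)"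

definition circuit :: "'e independence_structure \<Rightarrow> 'e set \<Rightarrow> bool" where
  "circuit M C \<longleftrightarrow> C \<subseteq> ground M \<and> C \<notin> indeps M \<and> (\<forall>D. D \<subset> C \<longrightarrow> D \<in> indeps M)"

definition simple_matroid :: "'e independence_structure \<Rightarrow> bool" where
  "simple_matroid M \<longleftrightarrow> matroid M \<and> (\<forall>C. circuit M C \<longrightarrow> card C \<noteq> 1 \<and> card C \<noteq> 2)"

definition connected_matroid :: "'e independence_structure \<Rightarrow> bool" where
  "connected_matroid M \<longleftrightarrow> matroid M \<and>
     (\<forall>e\<in>ground M. \<forall>f\<in>ground M. e \<noteq> f \<longrightarrow> (\<exists>C. circuit M C \<and> e \<in> C \<and> f \<in> C))"

definition matroid_delete ::
  "'e independence_structure \<Rightarrow> 'e \<Rightarrow> 'e independence_structure" where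
  "matroid_delete M e = \<lparr>ground = ground M - {e}, indeps = {I \<in> indeps M. e \<notin> I}\<rparr>"

definition single_element_extension ::
  "'e independence_structure \<Rightarrow> 'e independence_structure \<Rightarrow> 'e \<Rightarrow> bool" where
  "single_element_extension M N e \<longleftrightarrow> matroid N \<and> e \<in> ground N \<and> matroid_delete N e = M"

definition matroid_isomorphic ::
  "'e independence_structure \<Rightarrow> 'f independence_structure \<Rightarrow> bool" where
  "matroid_isomorphic M N \<longleftrightarrow>
     (\<exists>\<phi>. bij_betw \<phi> (ground M) (ground N) \<and>
          (\<forall>X\<subseteq>ground M. X \<in> indeps M \<longleftrightarrow> \<phi> ` X \<in> indeps N))"

section \<open>Labelled matrices and their vector matroids\<close>

text \<open>The label of column \<open>j\<close> of \<open>A\<close> is \<open>ls ! j\<close>. A set of labels is independent when the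
  corresponding \<^emph>\<open>multiset\<close> of columns is linearly independent, hence the injectivity condition:
  the image \<open>col A ` J\<close> alone would not see repeated columns.\<close>

definition vector_matroid :: "'a::field mat \<Rightarrow> 'e list \<Rightarrow> 'e independence_structure" where
  "vector_matroid A ls =
     \<lparr>ground = set ls,
      indeps = {(!) ls ` J | J. J \<subseteq> {..<dim_col A} \<and> inj_on (col A) J \<and>
        LinearCombinations.module.lin_indpt class_ring (module_vec TYPE('a) (dim_row A)) (col A ` J)}\<rparr>"

definition represents :: "'a::field mat \<Rightarrow> 'e list \<Rightarrow> 'e independence_structure \<Rightarrow> bool" where
  "represents A ls M \<longleftrightarrow> length ls = dim_col A \<and> distinct ls \<and> vector_matroid A ls = M"

definition representable_over :: "'a::field itself \<Rightarrow> 'e independence_structure \<Rightarrow> bool" where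
  "representable_over F M \<longleftrightarrow> (\<exists>(A :: 'a mat) ls. represents A ls M)"

definition append_cols :: "'a mat \<Rightarrow> 'a mat \<Rightarrow> 'a mat" (infixl "|||" 65) where
  "A ||| B = mat_of_cols (dim_row A) (cols A @ cols B)"

section \<open>Geometric equivalence\<close>

inductive geometric_step :: "'a::field mat \<Rightarrow> 'a mat \<Rightarrow> bool" where
  swap_rows: "\<lbrakk>k < dim_row A; l < dim_row A\<rbrakk> \<Longrightarrow> geometric_step A (swaprows k l A)"
| scale_row: "\<lbrakk>k < dim_row A; a \<noteq> 0\<rbrakk> \<Longrightarrow> geometric_step A (multrow k a A)"
| add_row: "\<lbrakk>k < dim_row A; l < dim_row A; k \<noteq> l\<rbrakk> \<Longrightarrow> geometric_step A (addrow a k l A)"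
| scale_col: "\<lbrakk>k < dim_col A; a \<noteq> 0\<rbrakk> \<Longrightarrow> geometric_step A (multcol k a A)"
| permute_cols: "p permutes {..<dim_col A} \<Longrightarrow>
    geometric_step A (mat (dim_row A) (dim_col A) (\<lambda>(i, j). A $$ (i, p j)))"

text \<open>Both labellings must give \<open>M\<close>, but the sequence of operations acts on the bare matrices.\<close>

definition geometrically_equivalent ::
  "'e independence_structure \<Rightarrow> 'a::field mat \<Rightarrow> 'e list \<Rightarrow> 'a mat \<Rightarrow> 'e list \<Rightarrow> bool" where
  "geometrically_equivalent M A ls A' ls' \<longleftrightarrow>
     represents A ls M \<and> represents A' ls' M \<and> geometric_step\<^sup>*\<^sup>* A A'"

section \<open>The matrix of a projective geometry\<close>

definition leading_one :: "'a::field vec \<Rightarrow> bool" where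
  "leading_one v \<longleftrightarrow> (\<exists>i<dim_vec v. v $ i = 1 \<and> (\<forall>j<i. v $ j = 0))"

lemma ex1_leading_one_in_line:
  fixes w :: "'a::field vec"
  assumes w: "w \<in> carrier_vec r" "w \<noteq> 0\<^sub>v r"
  shows "\<exists>!v. v \<in> range (\<lambda>c. c \<cdot>\<^sub>v w) \<and> leading_one v"
proof -
  have "\<exists>i. i < r \<and> w $ i \<noteq> 0"
  proof (rule ccontr)
    assume "\<not> ?thesis"
    hence "w = 0\<^sub>v r" using w by (intro eq_vecI) auto
    thus False using w by simp
  qed
  define i where "i = (LEAST i. i < r \<and> w $ i \<noteq> 0)"
  have i: "i < r" "w $ i \<noteq> 0"
    using LeastI_ex[OF \<open>\<exists>i. i < r \<and> w $ i \<noteq> 0\<close>] unfolding i_def by auto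
  have below: "w $ j = 0" if "j < i" for j
    using not_less_Least[of j "\<lambda>i. i < r \<and> w $ i \<noteq> 0"] that i unfolding i_def by fastforce
  have d: "dim_vec w = r" using w by auto
  show ?thesis
  proof (rule ex1I[of _ "inverse (w $ i) \<cdot>\<^sub>v w"])
    show "inverse (w $ i) \<cdot>\<^sub>v w \<in> range (\<lambda>c. c \<cdot>\<^sub>v w) \<and> leading_one (inverse (w $ i) \<cdot>\<^sub>v w)"
      using i below d unfolding leading_one_def by (auto intro!: exI[of _ i])
  next
    fix v assume "v \<in> range (\<lambda>c. c \<cdot>\<^sub>v w) \<and> leading_one v"
    then obtain c m where v: "v = c \<cdot>\<^sub>v w" and m: "m < r" "c * w $ m = 1"
      and mb: "\<And>j. j < m \<Longrightarrow> c * w $ j = 0"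
      using d unfolding leading_one_def by auto
    have "c \<noteq> 0" using m by auto
    have "m = i"
    proof (rule linorder_cases[of m i])
      assume "m < i" thus ?thesis using below[of m] m by simp
    next
      assume "i < m" thus ?thesis using mb[of i] i \<open>c \<noteq> 0\<close> by simp
    qed
    hence "c = inverse (w $ i)" using m i by (simp add: field_simps)
    thus "v = inverse (w $ i) \<cdot>\<^sub>v w" using v by simp
  qed
qed

text \<open>By \<open>ex1_leading_one_in_line\<close>, the vectors with leading entry 1 are exactly one representative
  from each one-dimensional subspace; the order of the columns is left open.\<close>

definition projective_geometry_matrix :: "nat \<Rightarrow> 'a::field mat \<Rightarrow> bool" where
  "projective_geometry_matrix r P \<longleftrightarrow>
     dim_row P = r \<and> distinct (cols P) \<and> set (cols P) = {v \<in> carrier_vec r. leading_one v}"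

end

theory Submission
  imports Defs
begin

text \<open>A representation of \<open>N\<close> restricts to one of \<open>M = N \ e\<close>, and the operations that carry the
  restricted matrix to some \<open>[I | D i]\<close> can be performed on the larger matrix as well: row operations
  act on the column of \<open>e\<close>, column operations leave it alone. What comes out represents a matroid
  isomorphic to \<open>N\<close>, the isomorphism being the relabelling caused by the column permutation, and it
  has the form \<open>[I | D i | x]\<close>. Scaling the last column turns \<open>x\<close> into a column of \<open>[I | L]\<close>.
  Simplicity of \<open>N\<close> says that \<open>x\<close> is not zero and not parallel to any other column; hence it is
  neither a unit vector, so it lies in \<open>L\<close>, nor a multiple of a column of \<open>D i\<close>.

  To start, the representation of \<open>N\<close> has to be brought into the form \<open>[I | D' | x']\<close> with the columns
  of \<open>[I | D']\<close> belonging to \<open>M\<close>. Since \<open>M\<close> and \<open>N\<close> have the same rank, a basis \<open>B\<close> of \<open>M\<close> is one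
  of \<open>N\<close>; instead of eliminating, one replaces each column by its coordinates with respect to the
  columns of \<open>B\<close> (\<open>standard_coordinates\<close>, \<open>representable_standard_form\<close>).

  Matrices are handled as families of vectors indexed by the labels. A set of labels is then
  independent if the family has no nontrivial relation on it, which treats repeated columns correctly
  without a side condition, and restriction and permutation of columns become invisible
  (\<open>vector_matroid_eq_family_matroid\<close>). Geometric equivalence enters only through its normal form: the
  columns of the second matrix are nonzero multiples of the images of the permuted columns of the first
  under one invertible matrix (\<open>geometric_steps_projectively_related\<close>). Such a correspondence of
  families preserves independence (\<open>family_matroid_isomorphic\<close>), and it extends over \<open>e\<close>
  simply by defining the image of the new vector.\<close>

section \<open>Linearly independent families of vectors\<close>

definition combination :: "nat \<Rightarrow> ('i \<Rightarrow> 'a::field vec) \<Rightarrow> 'i set \<Rightarrow> ('i \<Rightarrow> 'a) \<Rightarrow> 'a vec" where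
  "combination r v X f = vec r (\<lambda>i. \<Sum>x\<in>X. f x * v x $ i)"

definition independent_family :: "nat \<Rightarrow> ('i \<Rightarrow> 'a::field vec) \<Rightarrow> 'i set \<Rightarrow> bool" where
  "independent_family r v X \<longleftrightarrow> (\<forall>f. combination r v X f = 0\<^sub>v r \<longrightarrow> (\<forall>x\<in>X. f x = 0))"

definition family_matroid ::
  "nat \<Rightarrow> ('e \<Rightarrow> 'a::field vec) \<Rightarrow> 'e set \<Rightarrow> 'e independence_structure" where
  "family_matroid r v E = \<lparr>ground = E, indeps = {X. X \<subseteq> E \<and> independent_family r v X}\<rparr>"

lemma independent_familyI:
  assumes "\<And>f x. combination r v X f = 0\<^sub>v r \<Longrightarrow> x \<in> X \<Longrightarrow> f x = 0"
  shows "independent_family r v X"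
  using assms unfolding independent_family_def by blast

lemma independent_familyD:
  assumes "independent_family r v X" "combination r v X f = 0\<^sub>v r" "x \<in> X"
  shows "f x = 0"
  using assms unfolding independent_family_def by blast

lemma combination_cong:
  assumes "\<And>x. x \<in> X \<Longrightarrow> v x = w x" "\<And>x. x \<in> X \<Longrightarrow> f x = g x"
  shows "combination r v X f = combination r w X g"
  unfolding combination_def using assms by (auto intro!: eq_vecI sum.cong)

lemma independent_family_cong:
  assumes "\<And>x. x \<in> X \<Longrightarrow> v x = w x"
  shows "independent_family r v X \<longleftrightarrow> independent_family r w X"
proof -
  have "combination r v X f = combination r w X f" for f
    by (rule combination_cong) (simp_all add: assms)
  thus ?thesis unfolding independent_family_def by simp
qed

lemma combination_index [simp]:
  "i < r \<Longrightarrow> combination r v X f $ i = (\<Sum>x\<in>X. f x * v x $ i)"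
  "dim_vec (combination r v X f) = r"
  unfolding combination_def by auto

lemma combination_image:
  assumes "inj_on \<phi> X"
  shows "combination r v (\<phi> ` X) f = combination r (v \<circ> \<phi>) X (f \<circ> \<phi>)"
  unfolding combination_def using assms by (simp add: sum.reindex)

lemma independent_family_image:
  assumes inj: "inj_on \<phi> X"
  shows "independent_family r v (\<phi> ` X) \<longleftrightarrow> independent_family r (v \<circ> \<phi>) X"
proof
  assume ind: "independent_family r v (\<phi> ` X)"
  show "independent_family r (v \<circ> \<phi>) X"
  proof (rule independent_familyI)
    fix f x assume f: "combination r (v \<circ> \<phi>) X f = 0\<^sub>v r" and x: "x \<in> X"
    have "combination r v (\<phi> ` X) (f \<circ> inv_into X \<phi>) = combination r (v \<circ> \<phi>) X f"
      unfolding combination_image[OF inj] by (rule combination_cong) (auto simp: inj)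
    hence "(f \<circ> inv_into X \<phi>) (\<phi> x) = 0"
      using independent_familyD[OF ind, of "f \<circ> inv_into X \<phi>" "\<phi> x"] f x by simp
    thus "f x = 0" using inj x by simp
  qed
next
  assume ind: "independent_family r (v \<circ> \<phi>) X"
  show "independent_family r v (\<phi> ` X)"
  proof (rule independent_familyI)
    fix f y assume "combination r v (\<phi> ` X) f = 0\<^sub>v r" "y \<in> \<phi> ` X"
    thus "f y = 0"
      using independent_familyD[OF ind, of "f \<circ> \<phi>"] unfolding combination_image[OF inj] by auto
  qed
qed

lemma independent_family_scale:
  assumes c: "\<And>x. x \<in> X \<Longrightarrow> c x \<noteq> 0" and v: "\<And>x. x \<in> X \<Longrightarrow> v x \<in> carrier_vec r"
  shows "independent_family r (\<lambda>x. c x \<cdot>\<^sub>v v x) X \<longleftrightarrow> independent_family r v X"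
proof -
  have eq: "combination r (\<lambda>x. c x \<cdot>\<^sub>v v x) X f = combination r v X (\<lambda>x. f x * c x)" for f
    by (intro eq_vecI) (auto intro!: sum.cong simp: carrier_vecD[OF v])
  have eq': "combination r v X f = combination r v X (\<lambda>x. (f x / c x) * c x)" for f
    using c by (intro combination_cong) auto
  show ?thesis
  proof
    assume ind: "independent_family r (\<lambda>x. c x \<cdot>\<^sub>v v x) X"
    show "independent_family r v X"
    proof (rule independent_familyI)
      fix f x assume f: "combination r v X f = 0\<^sub>v r" and x: "x \<in> X"
      have "combination r (\<lambda>x. c x \<cdot>\<^sub>v v x) X (\<lambda>x. f x / c x) = combination r v X f"
        by (rule trans[OF eq eq'[symmetric]])
      hence "f x / c x = 0"
        using independent_familyD[OF ind _ x, of "\<lambda>x. f x / c x"] f by simp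
      thus "f x = 0" using c x by auto
    qed
  next
    assume ind: "independent_family r v X"
    show "independent_family r (\<lambda>x. c x \<cdot>\<^sub>v v x) X"
    proof (rule independent_familyI)
      fix f x assume "combination r (\<lambda>x. c x \<cdot>\<^sub>v v x) X f = 0\<^sub>v r" and x: "x \<in> X"
      hence "f x * c x = 0"
        by (intro independent_familyD[OF ind _ x, of "\<lambda>x. f x * c x"]) (simp only: eq)
      thus "f x = 0" using c x by auto
    qed
  qed
qed

lemma combination_mult_mat_vec:
  assumes P: "P \<in> carrier_mat r r" and v: "\<And>x. x \<in> X \<Longrightarrow> v x \<in> carrier_vec r"
  shows "combination r (\<lambda>x. P *\<^sub>v v x) X f = P *\<^sub>v combination r v X f"
proof (rule eq_vecI)
  fix i assume "i < dim_vec (P *\<^sub>v combination r v X f)"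
  hence i: "i < r" using P by simp
  have "combination r (\<lambda>x. P *\<^sub>v v x) X f $ i = (\<Sum>x\<in>X. \<Sum>k<r. f x * (P $$ (i, k) * v x $ k))"
    using i P by (auto intro!: sum.cong simp: carrier_vecD[OF v] scalar_prod_def sum_distrib_left lessThan_atLeast0)
  also have "\<dots> = (\<Sum>k<r. \<Sum>x\<in>X. f x * (P $$ (i, k) * v x $ k))"
    by (rule sum.swap)
  also have "\<dots> = (P *\<^sub>v combination r v X f) $ i"
    using i P by (auto intro!: sum.cong
        simp: scalar_prod_def sum_distrib_left lessThan_atLeast0 mult.left_commute)
  finally show "combination r (\<lambda>x. P *\<^sub>v v x) X f $ i = (P *\<^sub>v combination r v X f) $ i" .
qed (use P in auto)

lemma mult_mat_vec_eq_0_iff: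
  fixes P :: "'a::field mat"
  assumes P: "P \<in> carrier_mat r r" "Q \<in> carrier_mat r r" "Q * P = 1\<^sub>m r" and v: "v \<in> carrier_vec r"
  shows "P *\<^sub>v v = 0\<^sub>v r \<longleftrightarrow> v = 0\<^sub>v r"
proof
  assume "P *\<^sub>v v = 0\<^sub>v r"
  hence "Q *\<^sub>v (P *\<^sub>v v) = 0\<^sub>v r" using P by auto
  thus "v = 0\<^sub>v r" using P v by (simp flip: assoc_mult_mat_vec)
qed (use P in auto)

lemma independent_family_mult_mat_vec:
  assumes P: "P \<in> carrier_mat r r" "Q \<in> carrier_mat r r" "Q * P = 1\<^sub>m r"
    and v: "\<And>x. x \<in> X \<Longrightarrow> v x \<in> carrier_vec r"
  shows "independent_family r (\<lambda>x. P *\<^sub>v v x) X \<longleftrightarrow> independent_family r v X"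
proof -
  have "combination r (\<lambda>x. P *\<^sub>v v x) X f = 0\<^sub>v r \<longleftrightarrow> combination r v X f = 0\<^sub>v r" for f
  proof -
    have "combination r (\<lambda>x. P *\<^sub>v v x) X f = P *\<^sub>v combination r v X f"
      by (rule combination_mult_mat_vec[OF P(1) v])
    moreover have "combination r v X f \<in> carrier_vec r" by (simp add: combination_def)
    ultimately show ?thesis using mult_mat_vec_eq_0_iff[OF P] by simp
  qed
  thus ?thesis unfolding independent_family_def by simp
qed

lemma not_independent_family_parallel:
  assumes "x \<noteq> y" "v y \<in> carrier_vec r" "v x = c \<cdot>\<^sub>v v y"
  shows "\<not> independent_family r v {x, y}"
proof
  assume ind: "independent_family r v {x, y}"
  define f where "f z = (if z = x then 1 else - c)" for z
  have "combination r v {x, y} f = 0\<^sub>v r"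
    using assms by (intro eq_vecI) (auto simp: f_def)
  from independent_familyD[OF ind this, of x] show False by (simp add: f_def)
qed

lemma not_independent_family_zero:
  assumes "v x = 0\<^sub>v r"
  shows "\<not> independent_family r v {x}"
proof
  assume ind: "independent_family r v {x}"
  have "combination r v {x} (\<lambda>_. 1) = 0\<^sub>v r"
    using assms by (intro eq_vecI) auto
  from independent_familyD[OF ind this, of x] show False by simp
qed

section \<open>Vector matroids as matroids of families\<close>

text \<open>The injectivity condition on the left is what turns linear independence of the \<^emph>\<open>set\<close> of vectors
  into independence of the family: if \<open>v x = v y\<close> for \<open>x \<noteq> y\<close>, the coefficients \<open>1\<close> and \<open>-1\<close> are a
  nontrivial relation of the family.\<close>

lemma lin_indpt_iff_independent_family:
  fixes v :: "'i \<Rightarrow> 'a::field vec"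
  assumes finX: "finite X" and v: "v ` X \<subseteq> carrier_vec r"
  shows "inj_on v X \<and>
      LinearCombinations.module.lin_indpt class_ring (module_vec TYPE('a) r) (v ` X) \<longleftrightarrow>
    independent_family r v X"
proof -
  interpret vec_space "TYPE('a)" r .
  have comb: "lincomb a (v ` X) = combination r v X (a \<circ> v)" if "inj_on v X" for a
  proof (rule eq_vecI)
    have "lincomb a (v ` X) \<in> carrier_vec r" using v finX by (intro lincomb_closed) auto
    thus "dim_vec (lincomb a (v ` X)) = dim_vec (combination r v X (a \<circ> v))" by simp
    fix i assume "i < dim_vec (combination r v X (a \<circ> v))"
    thus "lincomb a (v ` X) $ i = combination r v X (a \<circ> v) $ i"
      using lincomb_index[OF _ v] that by (simp add: sum.reindex)
  qed
  show ?thesis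
  proof (intro iffI conjI; (elim conjE)?)
    assume inj: "inj_on v X" and li: "lin_indpt (v ` X)"
    show "independent_family r v X"
    proof (rule independent_familyI)
      fix f x assume f: "combination r v X f = 0\<^sub>v r" and x: "x \<in> X"
      define a where "a = f \<circ> inv_into X v"
      have "combination r v X (a \<circ> v) = combination r v X f"
        using inj by (intro combination_cong) (auto simp: a_def)
      hence "lincomb a (v ` X) = 0\<^sub>v r" using comb[OF inj] f by simp
      moreover have "finite (v ` X)" "v x \<in> v ` X" using finX x by auto
      ultimately have "a (v x) = 0"
        using li unfolding lin_dep_def by (auto simp: class_ring_simps)
      thus "f x = 0" using inj x by (simp add: a_def)
    qed
  next
    assume ind: "independent_family r v X"
    show inj: "inj_on v X"
    proof (rule inj_onI, rule ccontr)
      fix x y assume xy: "x \<in> X" "y \<in> X" "v x = v y" "x \<noteq> y"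
      define f where "f z = (if z = x then 1 else if z = y then - 1 else 0 :: 'a)" for z
      have "(\<Sum>z\<in>X. f z * v z $ i) = 0" for i
      proof -
        have "(\<Sum>z\<in>X. f z * v z $ i) = (\<Sum>z\<in>{x, y}. f z * v z $ i)"
          using finX xy by (intro sum.mono_neutral_right) (auto simp: f_def)
        also have "\<dots> = f x * v x $ i + f y * v y $ i" using xy(4) by simp
        also have "\<dots> = 0" using xy(3,4) by (simp add: f_def)
        finally show ?thesis .
      qed
      hence "combination r v X f = 0\<^sub>v r" by (intro eq_vecI) auto
      from independent_familyD[OF ind this xy(1)] show False by (simp add: f_def)
    qed
    show "lin_indpt (v ` X)"
    proof (rule finite_lin_indpt2)
      fix a assume "lincomb a (v ` X) = 0\<^sub>v r"
      hence "combination r v X (a \<circ> v) = 0\<^sub>v r" using comb[OF inj] by simp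
      thus "\<forall>u\<in>v ` X. a u = 0" using independent_familyD[OF ind] by fastforce
    qed (use finX v in auto)
  qed
qed

lemma vector_matroid_eq_family_matroid:
  fixes A :: "'a::field mat"
  assumes len: "length ls = dim_col A" and dist: "distinct ls"
    and w: "\<forall>j<length ls. w (ls ! j) = col A j"
  shows "vector_matroid A ls = family_matroid (dim_row A) w (set ls)"
proof -
  let ?r = "dim_row A"
  have ind: "inj_on (col A) J \<and>
      LinearCombinations.module.lin_indpt class_ring (module_vec TYPE('a) ?r) (col A ` J) \<longleftrightarrow>
      independent_family ?r w ((!) ls ` J)" if J: "J \<subseteq> {..<dim_col A}" for J
  proof -
    have fin: "finite J" using J finite_subset by blast
    have inj: "inj_on ((!) ls) J" using J dist len by (auto intro!: inj_on_nth)
    have "independent_family ?r w ((!) ls ` J) \<longleftrightarrow> independent_family ?r (col A) J"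
      unfolding independent_family_image[OF inj]
      using J w len by (intro independent_family_cong) auto
    moreover have "col A ` J \<subseteq> carrier_vec ?r" by (auto intro: col_dim)
    ultimately show ?thesis using lin_indpt_iff_independent_family[OF fin, of "col A" ?r] by simp
  qed
  have "X \<in> {(!) ls ` J | J. J \<subseteq> {..<dim_col A} \<and> inj_on (col A) J \<and>
        LinearCombinations.module.lin_indpt class_ring (module_vec TYPE('a) ?r) (col A ` J)} \<longleftrightarrow>
      X \<subseteq> set ls \<and> independent_family ?r w X" (is "X \<in> ?I \<longleftrightarrow> _") for X
  proof
    assume "X \<in> ?I"
    then obtain J where J: "X = (!) ls ` J" "J \<subseteq> {..<dim_col A}" and "inj_on (col A) J \<and>
        LinearCombinations.module.lin_indpt class_ring (module_vec TYPE('a) ?r) (col A ` J)"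
      by blast
    hence "independent_family ?r w X" using ind[OF J(2)] by simp
    moreover have "X \<subseteq> set ls" using J len by auto
    ultimately show "X \<subseteq> set ls \<and> independent_family ?r w X" by blast
  next
    assume X: "X \<subseteq> set ls \<and> independent_family ?r w X"
    moreover have "set ls = (!) ls ` {..<dim_col A}" using len by (auto simp: set_conv_nth)
    ultimately obtain J where J: "X = (!) ls ` J" "J \<subseteq> {..<dim_col A}"
      using subset_image_iff[of X "(!) ls" "{..<dim_col A}"] by auto
    have "inj_on (col A) J \<and>
        LinearCombinations.module.lin_indpt class_ring (module_vec TYPE('a) ?r) (col A ` J)"
      using X ind[OF J(2)] J(1) by simp
    thus "X \<in> ?I" using J by blast
  qed
  hence "{(!) ls ` J | J. J \<subseteq> {..<dim_col A} \<and> inj_on (col A) J \<and>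
        LinearCombinations.module.lin_indpt class_ring (module_vec TYPE('a) ?r) (col A ` J)} =
      {X. X \<subseteq> set ls \<and> independent_family ?r w X}"
    by (rule Set.set_eqI[OF trans[OF _ mem_Collect_eq[symmetric]]])
  thus ?thesis unfolding vector_matroid_def family_matroid_def by simp
qed

text \<open>Distinct labels are what allows to pass from column positions to labels.\<close>

lemma family_of_columns:
  assumes "distinct ls"
  obtains w where "\<forall>j<length ls. w (ls ! j) = col A j"
proof (rule that[of "\<lambda>x. col A (inv_into {..<length ls} ((!) ls) x)"], intro allI impI)
  fix j assume "j < length ls"
  thus "col A (inv_into {..<length ls} ((!) ls) (ls ! j)) = col A j"
    using assms by (subst inv_into_f_f) (auto intro: inj_on_nth)
qed

section \<open>Coordinates with respect to a basis\<close>

text \<open>In a nontrivial relation on \<open>insert e B\<close> the coefficient of \<open>e\<close> cannot vanish, because the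
  relation would then live on \<open>B\<close>; so the relation can be solved for \<open>v e\<close>.\<close>

lemma exists_coordinates:
  fixes v :: "'i \<Rightarrow> 'a::field vec"
  assumes fin: "finite B" and ind: "independent_family m v B" and e: "e \<notin> B"
    and dep: "\<not> independent_family m v (insert e B)"
  obtains a where "\<And>i. i < m \<Longrightarrow> v e $ i = (\<Sum>b\<in>B. a b * v b $ i)"
proof -
  from dep obtain f x where f: "combination m v (insert e B) f = 0\<^sub>v m"
    and x: "x \<in> insert e B" "f x \<noteq> 0"
    unfolding independent_family_def by blast
  have sum0: "f e * v e $ i + (\<Sum>b\<in>B. f b * v b $ i) = 0" if "i < m" for i
  proof -
    have "combination m v (insert e B) f $ i = 0" using f that by simp
    thus ?thesis using that fin e by simp
  qed
  have fe: "f e \<noteq> 0"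
  proof
    assume "f e = 0"
    hence "combination m v B f = 0\<^sub>v m" using sum0 by (intro eq_vecI) auto
    from independent_familyD[OF ind this] x \<open>f e = 0\<close> show False by auto
  qed
  show ?thesis
  proof (rule that[of "\<lambda>b. - f b / f e"])
    fix i assume i: "i < m"
    have "(\<Sum>b\<in>B. - f b / f e * v b $ i) = - (\<Sum>b\<in>B. f b * v b $ i) / f e"
      by (simp add: sum_divide_distrib sum_negf)
    also have "\<dots> = v e $ i"
      using sum0[OF i] fe by (simp add: field_simps add_eq_0_iff)
    finally show "v e $ i = (\<Sum>b\<in>B. - f b / f e * v b $ i)" ..
  qed
qed

text \<open>Expressing every vector in terms of a maximal independent set \<open>bs\<close> gives vectors of length
  \<open>length bs\<close> with the same linear relations: the coordinates of a linear combination are the same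
  linear combination of the coordinates, and they vanish exactly if the combination does, as \<open>bs\<close> is
  independent. This has the effect of a Gaussian elimination followed by the removal of zero rows.\<close>

lemma standard_coordinates:
  fixes v :: "'i \<Rightarrow> 'a::field vec"
  assumes bs: "distinct bs" "set bs \<subseteq> E"
    and ind: "independent_family m v (set bs)"
    and dep: "\<And>e. e \<in> E - set bs \<Longrightarrow> \<not> independent_family m v (insert e (set bs))"
  obtains w :: "'i \<Rightarrow> 'a::field vec" where "\<forall>e. w e \<in> carrier_vec (length bs)"
    and "\<forall>i<length bs. w (bs ! i) = unit_vec (length bs) i"
    and "\<forall>X\<subseteq>E. independent_family m v X \<longleftrightarrow> independent_family (length bs) w X"
proof -
  let ?r = "length bs"
  have "\<exists>a. \<forall>i<m. v e $ i = (\<Sum>b\<in>set bs. a b * v b $ i)" if e: "e \<in> E" for e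
  proof (cases "e \<in> set bs")
    case True
    thus ?thesis
      by (intro exI[of _ "\<lambda>b. if b = e then 1 else 0"]) (simp add: if_distrib[of "\<lambda>c. c * _"] cong: if_cong)
  next
    case False
    with exists_coordinates[OF _ ind False] dep e show ?thesis by blast
  qed
  then obtain a0 where a0: "\<And>e i. e \<in> E \<Longrightarrow> i < m \<Longrightarrow> v e $ i = (\<Sum>b\<in>set bs. a0 e b * v b $ i)"
    by metis
  \<comment> \<open>On \<open>bs\<close> itself the coordinates are fixed explicitly, so that they are visibly unit vectors.\<close>
  define a where "a e b = (if e \<in> set bs then if b = e then 1 else 0 else a0 e b)" for e b
  have a: "v e $ i = (\<Sum>b\<in>set bs. a e b * v b $ i)" if "e \<in> E" "i < m" for e i
  proof (cases "e \<in> set bs")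
    case True
    thus ?thesis by (simp add: a_def if_distrib[of "\<lambda>c. c * _"] cong: if_cong)
  next
    case False
    thus ?thesis using a0[OF that] by (simp add: a_def)
  qed
  define w where "w e = vec ?r (\<lambda>k. a e (bs ! k))" for e
  have comb: "combination m v X f = 0\<^sub>v m \<longleftrightarrow> combination ?r w X f = 0\<^sub>v ?r" if X: "X \<subseteq> E" for X f
  proof -
    let ?g = "\<lambda>b. \<Sum>x\<in>X. f x * a x b"
    have "combination m v X f = combination m v (set bs) ?g"
    proof (rule eq_vecI)
      fix i assume "i < dim_vec (combination m v (set bs) ?g)"
      hence i: "i < m" by simp
      have "combination m v X f $ i = (\<Sum>x\<in>X. \<Sum>b\<in>set bs. f x * (a x b * v b $ i))"
        using i X a by (auto simp: sum_distrib_left intro!: sum.cong)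
      also have "\<dots> = (\<Sum>b\<in>set bs. \<Sum>x\<in>X. f x * (a x b * v b $ i))" by (rule sum.swap)
      also have "\<dots> = combination m v (set bs) ?g $ i"
        using i by (simp add: sum_distrib_right mult.assoc)
      finally show "combination m v X f $ i = combination m v (set bs) ?g $ i" .
    qed auto
    moreover have "combination m v (set bs) ?g = 0\<^sub>v m \<longleftrightarrow> (\<forall>b\<in>set bs. ?g b = 0)"
      using independent_familyD[OF ind, of ?g] by (auto intro!: eq_vecI)
    moreover have "combination ?r w X f = 0\<^sub>v ?r \<longleftrightarrow> (\<forall>b\<in>set bs. ?g b = 0)"
    proof -
      have "combination ?r w X f = 0\<^sub>v ?r \<longleftrightarrow> (\<forall>k<?r. ?g (bs ! k) = 0)"
        unfolding vec_eq_iff by (simp add: w_def)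
      thus ?thesis by (simp add: all_set_conv_all_nth)
    qed
    ultimately show ?thesis by simp
  qed
  show ?thesis
  proof (rule that[of w])
    show "\<forall>e. w e \<in> carrier_vec ?r" by (simp add: w_def)
    show "\<forall>i<?r. w (bs ! i) = unit_vec ?r i"
    proof (intro allI impI)
      fix i assume "i < ?r"
      thus "w (bs ! i) = unit_vec ?r i"
        using bs(1) by (intro eq_vecI) (auto simp: w_def a_def nth_eq_iff_index_eq)
    qed
    show "\<forall>X\<subseteq>E. independent_family m v X \<longleftrightarrow> independent_family ?r w X"
      unfolding independent_family_def using comb by simp
  qed
qed

section \<open>Geometric equivalence\<close>

text \<open>The relation \<open>B = P A T\<close> with \<open>P\<close> invertible and \<open>T\<close> a monomial matrix, written by columns.
  The left inverse \<open>Q\<close> is kept as a witness because injectivity of \<open>P\<close> is the form in which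
  invertibility is applied.\<close>

definition projectively_related :: "'a::field mat \<Rightarrow> 'a mat \<Rightarrow> bool" where
  "projectively_related A B \<longleftrightarrow> dim_row B = dim_row A \<and> dim_col B = dim_col A \<and>
     (\<exists>P Q p c. P \<in> carrier_mat (dim_row A) (dim_row A) \<and> Q \<in> carrier_mat (dim_row A) (dim_row A) \<and>
        Q * P = 1\<^sub>m (dim_row A) \<and> p permutes {..<dim_col A} \<and>
        (\<forall>j<dim_col A. c j \<noteq> 0 \<and> col B j = c j \<cdot>\<^sub>v (P *\<^sub>v col A (p j))))"

lemma projectively_relatedI:
  assumes "dim_row B = dim_row A" "dim_col B = dim_col A"
    and "P \<in> carrier_mat (dim_row A) (dim_row A)" "Q \<in> carrier_mat (dim_row A) (dim_row A)"
    and "Q * P = 1\<^sub>m (dim_row A)" and "p permutes {..<dim_col A}"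
    and "\<And>j. j < dim_col A \<Longrightarrow> c j \<noteq> 0"
    and "\<And>j. j < dim_col A \<Longrightarrow> col B j = c j \<cdot>\<^sub>v (P *\<^sub>v col A (p j))"
  shows "projectively_related A B"
  unfolding projectively_related_def using assms by blast

lemma projectively_related_column_operation:
  assumes "dim_row B = dim_row A" "dim_col B = dim_col A" and "p permutes {..<dim_col A}"
    and "\<And>j. j < dim_col A \<Longrightarrow> c j \<noteq> 0"
    and "\<And>j. j < dim_col A \<Longrightarrow> col B j = c j \<cdot>\<^sub>v col A (p j)"
  shows "projectively_related A B"
  by (rule projectively_relatedI[of _ _ "1\<^sub>m (dim_row A)" "1\<^sub>m (dim_row A)" p c])
    (use assms in \<open>simp_all add: one_mult_mat_vec[OF col_dim]\<close>)

lemma projectively_related_left_mult: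
  assumes "P \<in> carrier_mat (dim_row A) (dim_row A)" "Q \<in> carrier_mat (dim_row A) (dim_row A)"
    "Q * P = 1\<^sub>m (dim_row A)"
  shows "projectively_related A (P * A)"
  by (rule projectively_relatedI[of _ _ P Q id "\<lambda>_. 1"])
    (use assms in \<open>auto intro: permutes_id simp: col_mult2[of _ "dim_row A" "dim_row A" _ "dim_col A"]\<close>)

text \<open>Row operations commute with column operations; this is why a sequence that interleaves them
  still collapses to one matrix, one permutation and one choice of scalars.\<close>

lemma projectively_related_trans:
  assumes "projectively_related A B" "projectively_related B C"
  shows "projectively_related A C"
proof -
  let ?r = "dim_row A" and ?n = "dim_col A"
  from assms(1) obtain P Q p c where dB: "dim_row B = ?r" "dim_col B = ?n"
    and P: "P \<in> carrier_mat ?r ?r" "Q \<in> carrier_mat ?r ?r" "Q * P = 1\<^sub>m ?r"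
    and p: "p permutes {..<?n}"
    and c: "\<And>j. j < ?n \<Longrightarrow> c j \<noteq> 0" "\<And>j. j < ?n \<Longrightarrow> col B j = c j \<cdot>\<^sub>v (P *\<^sub>v col A (p j))"
    unfolding projectively_related_def by blast
  from assms(2)[unfolded projectively_related_def dB] obtain P' Q' p' c'
    where dC: "dim_row C = ?r" "dim_col C = ?n"
    and P': "P' \<in> carrier_mat ?r ?r" "Q' \<in> carrier_mat ?r ?r" "Q' * P' = 1\<^sub>m ?r"
    and p': "p' permutes {..<?n}"
    and c': "\<And>j. j < ?n \<Longrightarrow> c' j \<noteq> 0" "\<And>j. j < ?n \<Longrightarrow> col C j = c' j \<cdot>\<^sub>v (P' *\<^sub>v col B (p' j))"
    by blast
  have "(Q * Q') * (P' * P) = Q * (Q' * (P' * P))"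
    by (rule assoc_mult_mat[OF P(2) P'(2)]) (use P P' in auto)
  also have "Q' * (P' * P) = (Q' * P') * P"
    by (rule assoc_mult_mat[OF P'(2,1) P(1), symmetric])
  also have "Q * \<dots> = 1\<^sub>m ?r" using P P' by simp
  finally have inv: "(Q * Q') * (P' * P) = 1\<^sub>m ?r" .
  have col: "col C j = (c' j * c (p' j)) \<cdot>\<^sub>v ((P' * P) *\<^sub>v col A ((p \<circ> p') j))" if j: "j < ?n" for j
  proof -
    have pj: "p' j < ?n" using p' j permutes_in_image[OF p', of j] by simp
    have "P' *\<^sub>v (c (p' j) \<cdot>\<^sub>v (P *\<^sub>v col A (p (p' j)))) = c (p' j) \<cdot>\<^sub>v (P' *\<^sub>v (P *\<^sub>v col A (p (p' j))))"
      using P P' by (intro mult_mat_vec) (auto intro: mult_mat_vec_carrier col_dim)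
    thus ?thesis
      using c'(2)[OF j] c(2)[OF pj] assoc_mult_mat_vec[OF P'(1) P(1) col_dim]
      by (simp add: smult_smult_assoc)
  qed
  have "P' * P \<in> carrier_mat ?r ?r" "Q * Q' \<in> carrier_mat ?r ?r" using P P' by auto
  thus ?thesis
  proof (rule projectively_relatedI[OF dC _ _ inv permutes_compose[OF p' p] _ col])
    fix j assume j: "j < ?n"
    hence "p' j < ?n" using permutes_in_image[OF p', of j] by simp
    thus "c' j * c (p' j) \<noteq> 0" using c(1) c'(1)[OF j] by simp
  qed
qed

text \<open>Row operations are left multiplications by elementary matrices.\<close>

lemma geometric_step_projectively_related:
  assumes "geometric_step A B"
  shows "projectively_related A B"
  using assms
proof cases
  case (swap_rows k l)
  thus ?thesis
    using projectively_related_left_mult[of "swaprows_mat (dim_row A) k l" A "swaprows_mat (dim_row A) k l"]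
      swaprows_mat_inv[of k "dim_row A" l] swaprows_mat[of A "dim_row A" "dim_col A" k l] by auto
next
  case (scale_row k a)
  thus ?thesis
    using projectively_related_left_mult[of "multrow_mat (dim_row A) k a" A "multrow_mat (dim_row A) k (inverse a)"]
      multrow_mat_inv[of k "dim_row A" "inverse a"] multrow_mat[of A "dim_row A" "dim_col A" k a] by auto
next
  case (add_row k l a)
  thus ?thesis
    using projectively_related_left_mult[of "addrow_mat (dim_row A) a k l" A "addrow_mat (dim_row A) (- a) k l"]
      addrow_mat_inv[of k "dim_row A" l "- a"] addrow_mat[of A "dim_row A" "dim_col A" l a k] by auto
next
  case (scale_col k a)
  show ?thesis
    by (rule projectively_related_column_operation[of _ _ id "\<lambda>j. if j = k then a else 1"])
      (use scale_col in \<open>auto intro: permutes_id\<close>)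
next
  case (permute_cols p)
  show ?thesis
  proof (rule projectively_related_column_operation[of _ _ p "\<lambda>_. 1"])
    fix j assume "j < dim_col A"
    thus "col B j = 1 \<cdot>\<^sub>v col A (p j)"
      using permute_cols permutes_in_image[of p "{..<dim_col A}" j] by (intro eq_vecI) auto
  qed (use permute_cols in auto)
qed

lemma geometric_steps_projectively_related:
  "geometric_step\<^sup>*\<^sup>* A B \<Longrightarrow> projectively_related A B"
proof (induction rule: rtranclp_induct)
  case base
  show ?case by (rule projectively_related_column_operation[of _ _ id "\<lambda>_. 1"]) (auto intro: permutes_id)
next
  case (step B C)
  thus ?case using projectively_related_trans geometric_step_projectively_related by blast
qed

text \<open>The permutation of the column positions, read through two labellings, is a bijection \<open>\<phi>\<close> between
  the labels. When both matrices represent the same matroid, \<open>\<phi>\<close> is an automorphism of it and in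
  general not the identity; it is the reason for an isomorphism instead of an equality in the
  theorem.\<close>

lemma projectively_related_labels:
  fixes A B :: "'a::field mat"
  assumes rel: "projectively_related A B" and r: "dim_row A = r"
    and ls: "distinct ls" "length ls = dim_col A" and ls': "distinct ls'" "length ls' = dim_col A"
    and w: "\<forall>j<length ls. w (ls ! j) = col A j"
    and u: "\<forall>j<length ls'. u (ls' ! j) = col B j"
  obtains P Q \<phi> c where "P \<in> carrier_mat r r" "Q \<in> carrier_mat r r" "Q * P = 1\<^sub>m r"
    "bij_betw \<phi> (set ls) (set ls')"
    "\<forall>x\<in>set ls. c x \<noteq> 0 \<and> u (\<phi> x) = c x \<cdot>\<^sub>v (P *\<^sub>v w x)"
proof -
  let ?n = "dim_col A"
  from rel r obtain P Q p c
    where P: "P \<in> carrier_mat r r" "Q \<in> carrier_mat r r" "Q * P = 1\<^sub>m r"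
    and p: "p permutes {..<?n}"
    and c: "\<And>j. j < ?n \<Longrightarrow> c j \<noteq> 0 \<and> col B j = c j \<cdot>\<^sub>v (P *\<^sub>v col A (p j))"
    unfolding projectively_related_def by blast
  have bij: "bij_betw ((!) ls \<circ> p) {..<?n} (set ls)"
    using permutes_imp_bij[OF p] bij_betw_nth[OF ls(1), of "{..<?n}" "set ls"] ls(2)
    by (auto intro: bij_betw_trans)
  define \<psi> where "\<psi> = inv_into {..<?n} ((!) ls \<circ> p)"
  have \<psi>: "bij_betw \<psi> (set ls) {..<?n}"
    unfolding \<psi>_def by (rule bij_betw_inv_into[OF bij])
  have "bij_betw ((!) ls' \<circ> \<psi>) (set ls) (set ls')"
    using \<psi> bij_betw_nth[OF ls'(1), of "{..<?n}" "set ls'"] ls'(2) by (auto intro: bij_betw_trans)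
  moreover have "\<forall>x\<in>set ls. (c \<circ> \<psi>) x \<noteq> 0 \<and>
      u (((!) ls' \<circ> \<psi>) x) = (c \<circ> \<psi>) x \<cdot>\<^sub>v (P *\<^sub>v w x)"
  proof
    fix x assume x: "x \<in> set ls"
    have j: "\<psi> x < ?n" using bij_betwE[OF \<psi>] x by auto
    have "x = ls ! p (\<psi> x)"
      using bij_betw_inv_into_right[OF bij x] by (simp add: \<psi>_def)
    moreover have "p (\<psi> x) < ?n" using permutes_in_image[OF p, of "\<psi> x"] j by simp
    ultimately have "w x = col A (p (\<psi> x))" using w ls(2) by metis
    thus "(c \<circ> \<psi>) x \<noteq> 0 \<and> u (((!) ls' \<circ> \<psi>) x) = (c \<circ> \<psi>) x \<cdot>\<^sub>v (P *\<^sub>v w x)"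
      using c[OF j] u j ls'(2) by simp
  qed
  ultimately show ?thesis by (rule that[OF P])
qed

section \<open>Simple matroids, rank and isomorphism\<close>

text \<open>The elements \<open>x\<close> and \<open>y\<close> may coincide, which gives the absence of loops.\<close>

lemma simple_matroid_indep:
  assumes M: "simple_matroid M" and xy: "x \<in> ground M" "y \<in> ground M"
  shows "{x, y} \<in> indeps M"
proof -
  have empty: "{} \<in> indeps M" using M unfolding simple_matroid_def matroid_def by blast
  have circ: "card C \<noteq> 1 \<and> card C \<noteq> 2" if "circuit M C" for C
    using M that unfolding simple_matroid_def by blast
  have single: "{z} \<in> indeps M" if "z \<in> ground M" for z
  proof (rule ccontr)
    assume "{z} \<notin> indeps M"
    hence "circuit M {z}" using that empty unfolding circuit_def by (auto simp: psubset_insert_iff)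
    from circ[OF this] show False by simp
  qed
  show ?thesis
  proof (rule ccontr)
    assume dep: "{x, y} \<notin> indeps M"
    hence "x \<noteq> y" using single xy by auto
    have "D \<in> indeps M" if "D \<subset> {x, y}" for D
    proof -
      have "D = {} \<or> D = {x} \<or> D = {y}" using that by auto
      thus ?thesis using empty single xy by auto
    qed
    hence "circuit M {x, y}" using xy dep unfolding circuit_def by auto
    from circ[OF this] \<open>x \<noteq> y\<close> show False by simp
  qed
qed

lemma matroid_card_indep_le_rank:
  assumes "matroid M" "I \<in> indeps M"
  shows "card I \<le> matroid_rank M"
proof -
  have "finite (indeps M)" using assms(1) unfolding matroid_def by (meson finite_Pow_iff finite_subset)
  thus ?thesis unfolding matroid_rank_def using assms(2) by (intro Max_ge) auto
qed

lemma matroid_obtain_basis: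
  assumes "matroid M"
  obtains B where "B \<in> indeps M" "card B = matroid_rank M"
proof -
  have "finite (indeps M)" "{} \<in> indeps M"
    using assms unfolding matroid_def by (meson finite_Pow_iff finite_subset, blast)
  hence "Max (card ` indeps M) \<in> card ` indeps M" by (intro Max_in) auto
  thus ?thesis using that unfolding matroid_rank_def by auto
qed

lemma family_matroid_isomorphic:
  assumes P: "P \<in> carrier_mat r r" "Q \<in> carrier_mat r r" "Q * P = 1\<^sub>m r"
    and \<phi>: "bij_betw \<phi> E F"
    and w: "\<And>x. x \<in> E \<Longrightarrow> w x \<in> carrier_vec r"
    and u: "\<And>x. x \<in> E \<Longrightarrow> c x \<noteq> 0 \<and> u (\<phi> x) = c x \<cdot>\<^sub>v (P *\<^sub>v w x)"
  shows "X \<subseteq> E \<Longrightarrow> independent_family r u (\<phi> ` X) \<longleftrightarrow> independent_family r w X"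
    and "matroid_isomorphic (family_matroid r w E) (family_matroid r u F)"
proof -
  show ind: "independent_family r u (\<phi> ` X) \<longleftrightarrow> independent_family r w X" if X: "X \<subseteq> E" for X
  proof -
    have inj: "inj_on \<phi> X" using \<phi> X by (meson bij_betw_def inj_on_subset)
    have "independent_family r u (\<phi> ` X) \<longleftrightarrow> independent_family r (\<lambda>x. c x \<cdot>\<^sub>v (P *\<^sub>v w x)) X"
      unfolding independent_family_image[OF inj] using u X by (intro independent_family_cong) auto
    also have "\<dots> \<longleftrightarrow> independent_family r (\<lambda>x. P *\<^sub>v w x) X"
      using u w X P(1) by (intro independent_family_scale) (auto intro!: mult_mat_vec_carrier)
    also have "\<dots> \<longleftrightarrow> independent_family r w X"
      using w X by (intro independent_family_mult_mat_vec[OF P]) auto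
    finally show ?thesis .
  qed
  show "matroid_isomorphic (family_matroid r w E) (family_matroid r u F)"
    unfolding matroid_isomorphic_def family_matroid_def
    using \<phi> ind by (intro exI[of _ \<phi>]) (auto dest: bij_betwE)
qed

section \<open>Standard form of a representable matroid and its extensions\<close>

text \<open>The basis \<open>B\<close> can be prescribed. Choosing one that avoids the new element of an extension puts
  the extension and the original matroid into standard form at the same time.\<close>

lemma representable_standard_form:
  fixes N :: "'e independence_structure"
  assumes N: "matroid N" "representable_over TYPE('a::field) N"
    and B: "B \<in> indeps N" "card B = matroid_rank N"
  obtains w :: "'e \<Rightarrow> 'a::field vec" and bs where "N = family_matroid (matroid_rank N) w (ground N)"
    "distinct bs" "set bs = B" "map w bs = unit_vecs (matroid_rank N)"
    "\<forall>x. w x \<in> carrier_vec (matroid_rank N)"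
proof -
  let ?r = "matroid_rank N"
  from N(2) obtain A :: "'a mat" and ls where A: "length ls = dim_col A" "distinct ls" "vector_matroid A ls = N"
    unfolding representable_over_def represents_def by blast
  obtain v where v: "\<forall>j<length ls. v (ls ! j) = col A j"
    by (rule family_of_columns[OF A(2), of A])
  define E where "E = ground N"
  have NE: "N = family_matroid (dim_row A) v E"
    using vector_matroid_eq_family_matroid[OF A(1,2) v] A(3) by (simp add: E_def family_matroid_def)
  hence ind: "X \<in> indeps N \<longleftrightarrow> X \<subseteq> E \<and> independent_family (dim_row A) v X" for X
    by (simp add: family_matroid_def)
  have "finite E" using N(1) by (simp add: matroid_def E_def)
  hence finB: "finite B" using B(1) ind finite_subset by blast
  then obtain bs where bs: "distinct bs" "set bs = B" using finite_distinct_list by blast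
  have len: "length bs = ?r" using bs B(2) distinct_card by fastforce
  have bsE: "set bs \<subseteq> E" and indbs: "independent_family (dim_row A) v (set bs)"
    using ind B(1) bs(2) by auto
  have dep: "\<not> independent_family (dim_row A) v (insert e (set bs))" if e: "e \<in> E - set bs" for e
  proof
    assume "independent_family (dim_row A) v (insert e (set bs))"
    hence "insert e B \<in> indeps N" using ind e B(1) bs by auto
    from matroid_card_indep_le_rank[OF N(1) this] show False using B(2) finB e bs by simp
  qed
  obtain w :: "'e \<Rightarrow> 'a vec" where w: "\<forall>e. w e \<in> carrier_vec ?r"
    "\<forall>i<?r. w (bs ! i) = unit_vec ?r i"
    "\<forall>X\<subseteq>E. independent_family (dim_row A) v X \<longleftrightarrow> independent_family ?r w X"
    by (rule standard_coordinates[OF bs(1) bsE indbs dep, unfolded len]) blast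
  show ?thesis
  proof (rule that[of w bs])
    show "N = family_matroid ?r w (ground N)"
    proof -
      have "family_matroid ?r w E = family_matroid (dim_row A) v E"
        unfolding family_matroid_def using w(3) by auto
      thus ?thesis using NE unfolding E_def by simp
    qed
    show "map w bs = unit_vecs ?r"
      using w(2) len by (intro nth_equalityI) (auto simp: unit_vecs_def)
  qed (use bs w(1) in \<open>auto simp: E_def\<close>)
qed

lemma cols_append_cols:
  assumes "dim_row B = dim_row A"
  shows "cols (A ||| B) = cols A @ cols B"
  unfolding append_cols_def using assms cols_dim[of A] cols_dim[of B]
  by (intro cols_mat_of_cols) auto

lemma matroid_delete_family_matroid:
  "matroid_delete (family_matroid r w E) e = family_matroid r w (E - {e})"
  unfolding matroid_delete_def family_matroid_def by auto

theorem mainTheorem1: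
  fixes q r k :: nat
    and M :: "'e independence_structure"
    and D :: "nat \<Rightarrow> 'a::{finite, field} mat"
    and lab :: "nat \<Rightarrow> 'e list"
    and L :: "'a mat"
  assumes "primepow q" and "card (UNIV :: 'a set) = q"
    and "connected_matroid M" and "simple_matroid M" and "matroid_rank M = r"
    and "representable_over TYPE('a) M"
    and "dim_row L = r" and "projective_geometry_matrix r (1\<^sub>m r ||| L)"
    and "\<And>i. i \<in> {1..k} \<Longrightarrow> dim_row (D i) = r \<and> represents (1\<^sub>m r ||| D i) (lab i) M"
    and "\<And>D' ls. dim_row D' = r \<Longrightarrow> represents (1\<^sub>m r ||| D') ls M \<Longrightarrow>
           \<exists>!i. i \<in> {1..k} \<and>
             geometrically_equivalent M (1\<^sub>m r ||| D') ls (1\<^sub>m r ||| D i) (lab i)"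
  shows "\<forall>N e. single_element_extension M N e \<and> simple_matroid N \<and> matroid_rank N = r \<and>
           representable_over TYPE('a) N \<longrightarrow>
           (\<exists>i\<in>{1..k}. \<exists>x\<in>set (cols L).
              (\<forall>d\<in>set (cols (D i)). \<forall>c. x \<noteq> c \<cdot>\<^sub>v d) \<and>
              matroid_isomorphic N
                (vector_matroid (1\<^sub>m r ||| D i ||| mat_of_cols r [x]) (lab i @ [e])))"
proof (intro allI impI, elim conjE)
  fix N e
  assume ext: "single_element_extension M N e" and simp: "simple_matroid N"
    and rank: "matroid_rank N = r" and repN: "representable_over TYPE('a) N"
  define E where "E = ground M"
  have N: "matroid N" "e \<in> ground N" "matroid_delete N e = M"
    using ext unfolding single_element_extension_def by auto
  have M: "matroid M" using assms(4) unfolding simple_matroid_def by blast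
  have E: "ground N = insert e E" "e \<notin> E"
    using N(2,3) unfolding E_def matroid_delete_def by auto
  have finE: "finite E" using M by (simp add: matroid_def E_def)

  \<comment> \<open>As the rank of \<open>N\<close> is also \<open>r\<close>, the set \<open>B\<close> is a basis of \<open>N\<close> that avoids \<open>e\<close>.\<close>
  obtain B where B: "B \<in> indeps M" "card B = r"
    using matroid_obtain_basis[OF M] assms(5) by metis
  have BN: "B \<in> indeps N" using B(1) N(3) unfolding matroid_delete_def by auto
  have BE: "B \<subseteq> E" using M B(1) unfolding matroid_def E_def by blast
  obtain w :: "'e \<Rightarrow> 'a vec" and bs where w: "N = family_matroid r w (ground N)"
    and bs: "distinct bs" "set bs = B" "map w bs = unit_vecs r"
    and wc': "\<forall>x. w x \<in> carrier_vec r"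
    by (rule representable_standard_form[OF N(1) repN BN, unfolded rank, OF B(2)]) blast
  have wc: "w x \<in> carrier_vec r" for x using wc' by blast
  have Mw: "M = family_matroid r w E"
  proof -
    have "M = matroid_delete (family_matroid r w (ground N)) e" using N(3) w by metis
    thus ?thesis using E by (simp add: matroid_delete_family_matroid)
  qed

  obtain ds where ds: "distinct ds" "set ds = E - B"
    using finite_distinct_list[of "E - B"] finE by blast
  define D' where "D' = mat_of_cols r (map w ds)"
  define ls where "ls = bs @ ds"
  have ls: "distinct ls" "set ls = E" using bs ds BE unfolding ls_def by auto
  have D'row: "dim_row D' = r" by (simp add: D'_def)
  have "cols D' = map w ds"
    unfolding D'_def using wc ds E by (intro cols_mat_of_cols) auto
  moreover have "cols (1\<^sub>m r :: 'a mat) = unit_vecs r"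
    by (simp add: cols_def unit_vecs_def)
  ultimately have colsA: "cols (1\<^sub>m r ||| D') = map w ls"
    using bs(3) D'row by (simp add: cols_append_cols ls_def)
  have lenA: "length ls = dim_col (1\<^sub>m r ||| D')"
    using arg_cong[OF colsA, of length] by simp
  have wA: "\<forall>j<length ls. w (ls ! j) = col (1\<^sub>m r ||| D') j"
  proof (intro allI impI)
    fix j assume "j < length ls"
    thus "w (ls ! j) = col (1\<^sub>m r ||| D') j"
      using arg_cong[OF colsA, of "\<lambda>c. c ! j"] lenA by simp
  qed
  have rowA: "dim_row (1\<^sub>m r ||| D') = r" by (simp add: append_cols_def)
  have "represents (1\<^sub>m r ||| D') ls M"
    unfolding represents_def
    using vector_matroid_eq_family_matroid[OF lenA ls(1) wA] lenA ls Mw rowA by simp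
  then obtain i where i: "i \<in> {1..k}"
    and geo: "geometrically_equivalent M (1\<^sub>m r ||| D') ls (1\<^sub>m r ||| D i) (lab i)"
    using assms(10)[OF D'row] by blast

  let ?A = "1\<^sub>m r ||| D i"
  have Di: "dim_row (D i) = r" and rep: "represents ?A (lab i) M" using assms(9)[OF i] by auto
  have rowAi: "dim_row ?A = r" by (simp add: append_cols_def)
  have rel: "projectively_related (1\<^sub>m r ||| D') ?A"
    using geo unfolding geometrically_equivalent_def by (blast intro: geometric_steps_projectively_related)
  have lab: "distinct (lab i)" "length (lab i) = dim_col ?A" "vector_matroid ?A (lab i) = M"
    using rep unfolding represents_def by auto
  have setlab: "set (lab i) = E"
    using lab(3) unfolding vector_matroid_def E_def by auto
  obtain u0 where u0: "\<forall>j<length (lab i). u0 (lab i ! j) = col ?A j"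
    by (rule family_of_columns[OF lab(1), of ?A])
  have "length (lab i) = dim_col (1\<^sub>m r ||| D')"
    using lab(2) rel unfolding projectively_related_def by simp
  note labels = projectively_related_labels[OF rel rowA ls(1) lenA lab(1) this wA u0]
  obtain P Q \<phi>0 c0 where P: "P \<in> carrier_mat r r" "Q \<in> carrier_mat r r" "Q * P = 1\<^sub>m r"
    and \<phi>0: "bij_betw \<phi>0 E E"
    and c0: "\<forall>x\<in>E. c0 x \<noteq> 0 \<and> u0 (\<phi>0 x) = c0 x \<cdot>\<^sub>v (P *\<^sub>v w x)"
    by (rule labels[unfolded ls(2) setlab]) blast

  have "indeps N = {X. X \<subseteq> ground N \<and> independent_family r w X}"
    by (subst w) (simp add: family_matroid_def)
  hence indN: "independent_family r w X" if "X \<in> indeps N" for X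
    using that by simp
  have "independent_family r w {e}"
    using indN[OF simple_matroid_indep[OF simp N(2) N(2)]] by simp
  hence "w e \<noteq> 0\<^sub>v r" using not_independent_family_zero[of w e r] by argo
  hence Pe: "P *\<^sub>v w e \<noteq> 0\<^sub>v r" "P *\<^sub>v w e \<in> carrier_vec r"
    using mult_mat_vec_eq_0_iff[OF P wc] P wc by auto
  \<comment> \<open>The column of \<open>e\<close> after the row operations, scaled to the point of the projective geometry
    that it spans.\<close>
  obtain x t where x: "x = t \<cdot>\<^sub>v (P *\<^sub>v w e)" "leading_one x"
    using ex1_implies_ex[OF ex1_leading_one_in_line[OF Pe(2,1)]] by blast
  have xc: "x \<in> carrier_vec r" using x(1) Pe(2) by simp
  have t: "t \<noteq> 0"
  proof
    assume "t = 0"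
    hence "x = 0\<^sub>v r" using x(1) P(1) by (auto intro!: eq_vecI)
    thus False using x(2) unfolding leading_one_def by auto
  qed

  \<comment> \<open>The correspondence between the two representations of \<open>M\<close>, extended to fix \<open>e\<close>.\<close>
  define u where "u = u0(e := x)"
  define \<phi> where "\<phi> = \<phi>0(e := e)"
  define c where "c = c0(e := t)"
  have \<phi>E: "\<phi> y \<in> E" if "y \<in> E" for y
    using that \<phi>0 E(2) bij_betwE by (fastforce simp: \<phi>_def)
  have \<phi>: "bij_betw \<phi> (insert e E) (insert e E)"
  proof -
    have "bij_betw \<phi> E E"
      using \<phi>0 E(2) by (subst bij_betw_cong[of _ _ \<phi>0]) (auto simp: \<phi>_def)
    moreover have "\<phi> e = e" by (simp add: \<phi>_def)
    ultimately show ?thesis using notIn_Un_bij_betw[of e E \<phi> E] E(2) by simp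
  qed
  have cu: "c y \<noteq> 0 \<and> u (\<phi> y) = c y \<cdot>\<^sub>v (P *\<^sub>v w y)" if "y \<in> insert e E" for y
    using that c0 t x(1) E(2) \<phi>E[of y] by (auto simp: u_def c_def \<phi>_def)
  note iso = family_matroid_isomorphic[where w = w and c = c and u = u, OF P \<phi> wc cu]

  \<comment> \<open>A parallel column would, by the isomorphism, give \<open>e\<close> a parallel element in \<open>N\<close>.\<close>
  have not_parallel: "x \<noteq> s \<cdot>\<^sub>v d" if d: "d \<in> set (cols ?A)" for d s
  proof
    assume eq: "x = s \<cdot>\<^sub>v d"
    obtain j where j: "j < dim_col ?A" "d = col ?A j" using d by (auto simp: cols_def)
    define z where "z = lab i ! j"
    have z: "z \<in> E" "u0 z = d" using j lab(2) setlab u0 by (auto simp: z_def)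
    obtain y where y: "y \<in> E" "\<phi> y = z"
      using z(1) \<phi>0 E(2) unfolding \<phi>_def bij_betw_def by (metis fun_upd_other imageE)
    have "z \<noteq> e" using z(1) E(2) by blast
    hence "\<not> independent_family r u {e, z}"
      using z(2) eq j rowAi by (intro not_independent_family_parallel[of _ _ _ _ s]) 
        (auto simp: u_def intro: col_carrier_vec)
    moreover have "\<phi> ` {e, y} = {e, z}"
      unfolding image_insert image_empty y(2) by (simp add: \<phi>_def)
    ultimately have "\<not> independent_family r w {e, y}" using iso(1)[of "{e, y}"] y by auto
    moreover have "independent_family r w {e, y}"
      by (rule indN, rule simple_matroid_indep[OF simp N(2)]) (simp add: E(1) y)
    ultimately show False by blast
  qed
  have colsAi: "cols ?A = cols (1\<^sub>m r) @ cols (D i)" by (rule cols_append_cols) (simp add: Di)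
  have "x \<in> set (cols (1\<^sub>m r ||| L))"
    using assms(8) xc x(2) unfolding projective_geometry_matrix_def by auto
  hence "x \<in> set (cols (1\<^sub>m r)) \<or> x \<in> set (cols L)"
    using assms(7) by (simp add: cols_append_cols)
  moreover have "x \<notin> set (cols (1\<^sub>m r))"
    using not_parallel[of x 1] colsAi by auto
  ultimately have xL: "x \<in> set (cols L)" by blast

  let ?A' = "?A ||| mat_of_cols r [x]"
  have colsA': "cols ?A' = cols ?A @ [x]"
    using xc rowAi by (simp add: cols_append_cols)
  have lenA': "length (lab i @ [e]) = dim_col ?A'"
    using arg_cong[OF colsA', of length] lab(2) by simp
  have "\<forall>j<length (lab i @ [e]). u ((lab i @ [e]) ! j) = col ?A' j"
  proof (intro allI impI)
    fix j assume j: "j < length (lab i @ [e])"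
    have "col ?A' j = (cols ?A @ [x]) ! j" using arg_cong[OF colsA', of "\<lambda>c. c ! j"] j lenA' by simp
    moreover have "lab i ! j \<noteq> e" if "j < length (lab i)" using that setlab E(2) nth_mem by blast
    ultimately show "u ((lab i @ [e]) ! j) = col ?A' j"
      using j lab(2) u0 by (auto simp: nth_append u_def)
  qed
  from vector_matroid_eq_family_matroid[OF lenA' _ this] lab(1) setlab E(2)
  have "vector_matroid ?A' (lab i @ [e]) = family_matroid r u (insert e E)"
    by (simp add: append_cols_def)
  hence "matroid_isomorphic N (vector_matroid ?A' (lab i @ [e]))"
    using iso(2) by (subst w) (simp add: E(1))
  thus "\<exists>i\<in>{1..k}. \<exists>x\<in>set (cols L). (\<forall>d\<in>set (cols (D i)). \<forall>c. x \<noteq> c \<cdot>\<^sub>v d) \<and>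
      matroid_isomorphic N (vector_matroid (1\<^sub>m r ||| D i ||| mat_of_cols r [x]) (lab i @ [e]))"
    using i xL not_parallel colsAi by (intro bexI[of _ i] bexI[of _ x]) auto
qed

end
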